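(* Let $N\ge 3$. Let $V:(0,+\infty)\to[0,+\infty)$ and $K:(0,+\infty)\to(0,+\infty)$ be continuous, and assume that there is $C>0$ such that $V(r)\le C/r^2$ for all $r\in(0,1)$. Assume that there exists $R_1>0$ such that $$\sup_{r\in(0,R_1)}\frac{K(r)}{r^{\alpha_0}V(r)^{\beta_0}}<+\infty\quad\text{for some } 0\le\beta_0\le 1 \text{ and } \alpha_0>\alpha^*(\beta_0).$$ Then $\lim_{R\to0^+}\mathcal{S}_0(q_1,R)=0$ for every $q_1\in\mathbb{R}$ such that $$\max\{1,2\beta_0\}<q_1<q_0^*(\alpha_0,\beta_0).$$
   Context: $f\in C^\infty(\mathbb{R},\mathbb{R})$ denotes the unique solution of the Cauchy problem $f'(t)=\frac{1}{\sqrt{1+2f(t)^2}}$ for $t\in\mathbb{R}$, $f(0)=0$. $C^\infty_{c,r}(\mathbb{R}^N)$ is the space of radial $C^\infty$ real functions with compact support in $\mathbb{R}^N$, and $D^{1,2}_r(\mathbb{R}^N)$ is its closure with respect to the norm $\|u\|_{1,2}=\left(\int_{\mathbb{R}^N}|\nabla u|^2dx\right)^{1/2}$. $E=\{u\in D^{1,2}_r(\mathbb{R}^N): \int_{\mathbb{R}^N}V(|x|)f(u)^2dx<+\infty\}$, endowed with the norm $\|u\|=\|u\|_{1,2}+\|u\|_o$, where $\|u\|_o=\inf_{k>0}\frac1k\left[1+\int_{\mathbb{R}^N}V(|x|)f(ku)^2dx\right]$; it is a Banach space. $B_R=\{x\in\mathbb{R}^N:|x|<R\}$. For $R>0$ and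 $q>1$, $\mathcal{S}_0(q,R)=\sup_{u\in E,\,\|u\|=1}\int_{B_R}K(|x|)|u|^q\,dx\in[0,+\infty]$. For $\alpha\in\mathbb{R}$, $\beta\in[0,1]$: $\alpha^*(\beta)=\max\left\{\beta\frac{N+2}{2}-1-\frac N2,\ \frac\beta2(3N-2)-N\right\}$ and $q_0^*(\alpha,\beta)=\frac{2\alpha+2N-\beta(N+2)}{N-2}$. Convention: $V(r)^0=1$ for every $r$ (even if $V(r)=0$); a quotient $K(r)/(r^\alpha V(r)^\beta)$ with $\beta>0$ and $V(r)=0$ is understood as $+\infty$. *)

theory Defs
  imports "HOL-Analysis.Analysis"
begin

definition dual_f_ode :: "(real \<Rightarrow> real) \<Rightarrow> bool" where
  "dual_f_ode g \<longleftrightarrow> g 0 = 0 \<and>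
     (\<forall>t. (g has_real_derivative 1 / sqrt (1 + 2 * (g t)\<^sup>2)) (at t))"

definition dual_f :: "real \<Rightarrow> real" where
  "dual_f = (THE g. dual_f_ode g)"

lemma dual_f_ode_ex1: "\<exists>!g. dual_f_ode g"
proof -
  define F :: "real \<Rightarrow> real" where
    "F s = s * sqrt (1 + 2 * s\<^sup>2) / 2 + arsinh (sqrt 2 * s) / (2 * sqrt 2)" for s
  have pos: "1 + 2 * s\<^sup>2 > 0" for s :: real
    by (intro add_pos_nonneg) auto
  have F0: "F 0 = 0" by (simp add: F_def)
  have dF: "(F has_real_derivative sqrt (1 + 2 * s\<^sup>2)) (at s)" for s
  proof -
    have sq: "sqrt (1 + 2 * s\<^sup>2) * sqrt (1 + 2 * s\<^sup>2) = 1 + 2 * s\<^sup>2"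
      using pos[of s] by simp
    define w where "w = sqrt (1 + 2 * s\<^sup>2)"
    have w: "w > 0" "w * w = 1 + 2 * s\<^sup>2" using pos[of s] sq by (auto simp: w_def)
    have 1: "((\<lambda>s. arsinh (sqrt 2 * s)) has_real_derivative 1 / w * sqrt 2) (at s)"
    proof (rule DERIV_chain2[where f = arsinh])
      show "(arsinh has_real_derivative 1 / w) (at (sqrt 2 * s))"
        using arsinh_real_has_field_derivative[of "sqrt 2 * s" UNIV]
        by (simp add: w_def power_mult_distrib add.commute)
      show "((\<lambda>s. sqrt 2 * s) has_real_derivative sqrt 2) (at s)"
        by (auto intro!: derivative_eq_intros)
    qed
    have 2: "((\<lambda>s. sqrt (1 + 2 * s\<^sup>2)) has_real_derivative inverse w / 2 * (4 * s)) (at s)"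
      unfolding w_def using pos[of s] by (auto intro!: derivative_eq_intros)
    have "(F has_real_derivative
        (1 * sqrt (1 + 2 * s\<^sup>2) + inverse w / 2 * (4 * s) * s) / 2 +
        1 / w * sqrt 2 / (2 * sqrt 2)) (at s)"
      unfolding F_def by (intro DERIV_add DERIV_cdivide DERIV_mult DERIV_ident 1 2)
    moreover have "(1 * sqrt (1 + 2 * s\<^sup>2) + inverse w / 2 * (4 * s) * s) / 2 +
        1 / w * sqrt 2 / (2 * sqrt 2) = w"
      using w unfolding w_def[symmetric] by (simp add: field_simps power2_eq_square)
    ultimately show ?thesis by (simp add: w_def)
  qed
  have contF: "continuous_on A F" for A
    using dF by (meson DERIV_isCont continuous_at_imp_continuous_on)
  have smF: "F x < F y" if "x < y" for x y
    by (rule DERIV_pos_imp_increasing[OF that]) (use dF pos in \<open>metis real_sqrt_gt_zero\<close>)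
  have inj: "F x = F y \<Longrightarrow> x = y" for x y
    by (metis smF less_irrefl linorder_neqE)
  have growth: "F s \<ge> s" if "s \<ge> 0" for s
  proof -
    have "(\<lambda>s. F s - s) 0 \<le> (\<lambda>s. F s - s) s"
    proof (rule DERIV_nonneg_imp_nondecreasing[OF that])
      fix x :: real
      have "((\<lambda>s. F s - s) has_real_derivative sqrt (1 + 2 * x\<^sup>2) - 1) (at x)"
        by (intro derivative_intros dF)
      moreover have "sqrt (1 + 2 * x\<^sup>2) - 1 \<ge> 0" by simp
      ultimately show "\<exists>y. ((\<lambda>s. F s - s) has_real_derivative y) (at x) \<and> 0 \<le> y" by blast
    qed
    then show ?thesis using F0 by simp
  qed
  have odd: "F (- s) = - F s" for s by (simp add: F_def arsinh_minus_real)
  have surj: "\<exists>s. F s = t" for t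
  proof -
    have u: "F \<bar>t\<bar> \<ge> t" using growth[of "\<bar>t\<bar>"] by simp
    have l: "F (- \<bar>t\<bar>) \<le> t" using growth[of "\<bar>t\<bar>"] odd[of "\<bar>t\<bar>"] by simp
    show ?thesis using IVT'[of F "- \<bar>t\<bar>" t "\<bar>t\<bar>"] u l contF by auto
  qed
  obtain g where Fg: "F (g t) = t" for t
    using choice[of "\<lambda>t s. F s = t"] surj by blast
  have gF: "g (F s) = s" for s by (rule inj) (rule Fg)
  have dg: "(g has_real_derivative 1 / sqrt (1 + 2 * (g t)\<^sup>2)) (at t)" for t
  proof -
    have "isCont g (F (g t))"
      by (rule isCont_inverse_function[where d = 1]) (simp_all add: gF DERIV_isCont[OF dF])
    then have "isCont g t" by (simp add: Fg)
    then have "(g has_real_derivative inverse (sqrt (1 + 2 * (g t)\<^sup>2))) (at t)"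
      using pos[of "g t"] Fg
      by (intro DERIV_inverse_function[where f = F and a = "t - 1" and b = "t + 1"] dF) auto
    then show ?thesis by (simp add: inverse_eq_divide)
  qed
  have ex: "dual_f_ode g"
    unfolding dual_f_ode_def using dg gF[of 0] F0 by simp
  moreover have "h = g" if h: "dual_f_ode h" for h
  proof
    fix t
    have "((\<lambda>t. F (h t) - t) has_real_derivative 0) (at x)" for x
    proof -
      have "((\<lambda>t. F (h t)) has_real_derivative
              sqrt (1 + 2 * (h x)\<^sup>2) * (1 / sqrt (1 + 2 * (h x)\<^sup>2))) (at x)"
        using h unfolding dual_f_ode_def by (intro DERIV_chain2[where f = F] dF) auto
      moreover have "sqrt (1 + 2 * (h x)\<^sup>2) * (1 / sqrt (1 + 2 * (h x)\<^sup>2)) = 1"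
        using pos[of "h x"] by simp
      ultimately have "((\<lambda>t. F (h t)) has_real_derivative 1) (at x)" by simp
      from DERIV_diff[OF this DERIV_ident] show ?thesis by simp
    qed
    then have "F (h t) - t = F (h 0) - 0"
      using DERIV_isconst_all[of "\<lambda>t. F (h t) - t" t 0] by blast
    then have "F (h t) = t" using h F0 by (simp add: dual_f_ode_def)
    then show "h t = g t" using gF[of "h t"] by simp
  qed
  ultimately show ?thesis by blast
qed

fun Ck :: "nat \<Rightarrow> ('a::euclidean_space \<Rightarrow> real) \<Rightarrow> bool" where
  "Ck 0 g \<longleftrightarrow> continuous_on UNIV g"
| "Ck (Suc k) g \<longleftrightarrow> g differentiable_on UNIV \<and>
     (\<forall>b\<in>Basis. Ck k (\<lambda>x. frechet_derivative g (at x) b))"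

definition Cc_inf :: "('a::euclidean_space \<Rightarrow> real) set" where
  "Cc_inf = {g. (\<forall>k. Ck k g) \<and> compact (closure {x. g x \<noteq> 0})}"

definition Cc_inf_rad :: "('a::euclidean_space \<Rightarrow> real) set" where
  "Cc_inf_rad = {g \<in> Cc_inf. \<forall>x y. norm x = norm y \<longrightarrow> g x = g y}"

definition grad :: "('a::euclidean_space \<Rightarrow> real) \<Rightarrow> 'a \<Rightarrow> 'a" where
  "grad g x = (\<Sum>b\<in>Basis. frechet_derivative g (at x) b *\<^sub>R b)"

definition has_weak_grad :: "('a::euclidean_space \<Rightarrow> real) \<Rightarrow> ('a \<Rightarrow> 'a) \<Rightarrow> bool" where
  "has_weak_grad u G \<longleftrightarrow>
     (\<forall>S. compact S \<longrightarrow> u absolutely_integrable_on S \<and> G absolutely_integrable_on S) \<and>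
     (\<forall>\<psi>\<in>Cc_inf. \<forall>b\<in>Basis.
        (LINT x|lebesgue. u x * (grad \<psi> x \<bullet> b)) = - (LINT x|lebesgue. (G x \<bullet> b) * \<psi> x))"

text \<open>Functions are representatives of their classes modulo equality almost everywhere; the weak
  gradient is determined almost everywhere, so only integrals of \<open>weak_grad u\<close> are meaningful.\<close>

definition weak_grad :: "('a::euclidean_space \<Rightarrow> real) \<Rightarrow> 'a \<Rightarrow> 'a" where
  "weak_grad u = (SOME G. has_weak_grad u G)"

definition norm12 :: "('a::euclidean_space \<Rightarrow> real) \<Rightarrow> real" where
  "norm12 u = sqrt (LINT x|lebesgue. (norm (weak_grad u x))\<^sup>2)"

definition sobolev_exp :: "real \<Rightarrow> real" where
  "sobolev_exp N = 2 * N / (N - 2)"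

text \<open>The closure of the radial test functions in the gradient norm, realised as a space of
  functions (dimension at least 3): by the Sobolev inequality a sequence of test functions that is
  Cauchy in the gradient norm converges in \<open>L\<close> with the critical exponent, and its limit in the
  completion is identified with that function, whose weak gradient is the \<open>L\<^sup>2\<close> limit of the
  gradients.\<close>

definition D12_rad :: "('a::euclidean_space \<Rightarrow> real) set" where
  "D12_rad = {u. (\<exists>G. has_weak_grad u G) \<and>
     (\<exists>\<phi> :: nat \<Rightarrow> 'a \<Rightarrow> real. (\<forall>n. \<phi> n \<in> Cc_inf_rad) \<and>
        (\<lambda>n. \<integral>\<^sup>+x. ennreal ((norm (grad (\<phi> n) x - weak_grad u x))\<^sup>2) \<partial>lebesgue)
          \<longlonglongrightarrow> 0 \<and>
        (\<lambda>n. \<integral>\<^sup>+x. ennreal (\<bar>\<phi> n x - u x\<bar> powr sobolev_exp (real DIM('a))) \<partial>lebesgue)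
          \<longlonglongrightarrow> 0)}"

definition E_space :: "(real \<Rightarrow> real) \<Rightarrow> ('a::euclidean_space \<Rightarrow> real) set" where
  "E_space V = {u \<in> D12_rad. (\<integral>\<^sup>+x. ennreal (V (norm x) * (dual_f (u x))\<^sup>2) \<partial>lebesgue) < \<infinity>}"

definition norm_o :: "(real \<Rightarrow> real) \<Rightarrow> ('a::euclidean_space \<Rightarrow> real) \<Rightarrow> ennreal" where
  "norm_o V u = (INF k\<in>{0<..}. ennreal (1 / k) *
     (1 + (\<integral>\<^sup>+x. ennreal (V (norm x) * (dual_f (k * u x))\<^sup>2) \<partial>lebesgue)))"

definition E_norm :: "(real \<Rightarrow> real) \<Rightarrow> ('a::euclidean_space \<Rightarrow> real) \<Rightarrow> ennreal" where
  "E_norm V u = ennreal (norm12 u) + norm_o V u"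

definition S0 :: "'a::euclidean_space itself \<Rightarrow> (real \<Rightarrow> real) \<Rightarrow> (real \<Rightarrow> real) \<Rightarrow>
    real \<Rightarrow> real \<Rightarrow> ennreal" where
  "S0 _ V K q R = (SUP u\<in>{u :: 'a \<Rightarrow> real. u \<in> E_space V \<and> E_norm V u = 1}.
     \<integral>\<^sup>+x\<in>ball 0 R. ennreal (K (norm x) * \<bar>u x\<bar> powr q) \<partial>lebesgue)"

definition alpha_star :: "real \<Rightarrow> real \<Rightarrow> real" where
  "alpha_star N \<beta> = max (\<beta> * ((N + 2) / 2) - 1 - N / 2) (\<beta> / 2 * (3 * N - 2) - N)"

definition q0_star :: "real \<Rightarrow> real \<Rightarrow> real \<Rightarrow> real" where
  "q0_star N \<alpha> \<beta> = (2 * \<alpha> + 2 * N - \<beta> * (N + 2)) / (N - 2)"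

text \<open>The power \<open>V r\<close> to the \<open>\<beta>\<close> is 1 for \<open>\<beta> = 0\<close> even if \<open>V r = 0\<close>, unlike \<open>powr\<close>. Division in
  \<open>ennreal\<close> makes the quotient infinite when \<open>V r = 0\<close>, \<open>\<beta> > 0\<close> and \<open>K r > 0\<close>.\<close>

definition weight_quotient ::
    "(real \<Rightarrow> real) \<Rightarrow> (real \<Rightarrow> real) \<Rightarrow> real \<Rightarrow> real \<Rightarrow> real \<Rightarrow> ennreal" where
  "weight_quotient K V \<alpha> \<beta> r =
     ennreal (K r) / ennreal (r powr \<alpha> * (if \<beta> = 0 then 1 else V r powr \<beta>))"

end

theory Submission
  imports Defs
begin

text \<open>The integral of \<open>K |u|\<^sup>q\<close> over a small ball is controlled by two quantities that stay bounded on
  the unit sphere of the norm: the weighted integral of \<open>m u = min u\<^sup>2 |u|\<close>, which is at most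
  \<open>4 (dual_f u)\<^sup>2\<close>, and the pointwise size of \<open>u\<close>.

  For the first, the infimum defining \<open>norm_o V u\<close> is nearly attained at some \<open>k\<close>, and \<open>m t\<close> is
  at most \<open>2 / k\<close> times \<open>m (k t)\<close>, so \<open>norm_o V u \<le> 1\<close> gives \<open>\<integral> V m(u) \<le> 16\<close>
  (\<open>weighted_integral_le_if_norm_o_le_1\<close>).

  For the second, a radial test function is integrated along a ray from outside its support, and
  the gradient energy in polar coordinates bounds the result by a constant times
  \<open>|x|\<close> to the power \<open>-(N-2)/2\<close>; Fatou's lemma carries this to the closure
  (\<open>radial_estimate_D12_rad\<close>).

  Write \<open>K \<le> M r\<^sup>\<alpha> V\<^sup>\<beta>\<close>. The factor \<open>V\<^sup>\<beta>\<close> is paired with \<open>m(u)\<^sup>\<beta>\<close>, and what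
  remains of \<open>|u|\<^sup>q\<close> is at most a constant times \<open>|x|\<close> to the power
  \<open>-(N-2)(q-\<beta>)/2\<close>. Put \<open>\<epsilon> = \<alpha> - (N-2)(q-\<beta>)/2 + N(1-\<beta>)\<close>. A geometric mean lies
  below the sum of its terms, so the integrand is bounded by a constant times
  \<open>|x|\<^sup>\<epsilon> V m(u)\<close> plus \<open>|x|\<close> to the power \<open>\<epsilon> - N\<close> (\<open>weighted_power_bound\<close>). The
  condition \<open>q < q0_star N \<alpha> \<beta>\<close> says exactly that \<open>\<epsilon> > 0\<close>, and then both terms integrate to
  \<open>O(R\<^sup>\<epsilon>)\<close> over the ball of radius \<open>R\<close>, uniformly in \<open>u\<close>.\<close>

section \<open>Lower bound for the dual function\<close>

lemma dual_f_ode_dual_f: "dual_f_ode dual_f"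
  unfolding dual_f_def by (rule theI'[OF dual_f_ode_ex1])

lemma DERIV_dual_f: "(dual_f has_real_derivative 1 / sqrt (1 + 2 * (dual_f t)\<^sup>2)) (at t)"
  using dual_f_ode_dual_f unfolding dual_f_ode_def by blast

lemma dual_f_0 [simp]: "dual_f 0 = 0"
  using dual_f_ode_dual_f unfolding dual_f_ode_def by blast

lemma continuous_on_dual_f: "continuous_on A dual_f"
  using DERIV_dual_f by (meson DERIV_isCont continuous_at_imp_continuous_on)

lemma dual_f_minus: "dual_f (- t) = - dual_f t"
proof -
  have "dual_f_ode (\<lambda>t. - dual_f (- t))"
    unfolding dual_f_ode_def
  proof (intro conjI allI)
    fix t
    have "((\<lambda>t. dual_f (- t)) has_real_derivative 1 / sqrt (1 + 2 * (dual_f (- t))\<^sup>2) * (- 1)) (at t)"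
      by (rule DERIV_chain2[OF DERIV_dual_f]) (auto intro!: derivative_eq_intros)
    from DERIV_minus[OF this]
    show "((\<lambda>t. - dual_f (- t)) has_real_derivative 1 / sqrt (1 + 2 * (- dual_f (- t))\<^sup>2)) (at t)"
      by simp
  qed simp
  with dual_f_ode_ex1 dual_f_ode_dual_f have "(\<lambda>t. - dual_f (- t)) = dual_f" by blast
  then show ?thesis by (metis minus_minus)
qed

lemma dual_f_nonneg: "t \<ge> 0 \<Longrightarrow> dual_f t \<ge> 0"
  using DERIV_nonneg_imp_nondecreasing[of 0 t dual_f] DERIV_dual_f
  by (metis add_nonneg_nonneg divide_nonneg_nonneg dual_f_0 mult_nonneg_nonneg
      real_sqrt_ge_0_iff zero_le_numeral zero_le_one zero_le_power2)

text \<open>For \<open>t \<ge> 0\<close> the derivative of \<open>f + f\<^sup>2\<close> is \<open>(1 + 2 f) / sqrt (1 + 2 f\<^sup>2)\<close>, which is at least 1;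
  oddness covers \<open>t < 0\<close>.\<close>

lemma abs_le_dual_f: "\<bar>t\<bar> \<le> \<bar>dual_f t\<bar> + (dual_f t)\<^sup>2"
proof -
  have *: "t \<le> dual_f t + (dual_f t)\<^sup>2" if "t \<ge> 0" for t
  proof -
    have "(\<lambda>t. dual_f t + (dual_f t)\<^sup>2 - t) 0 \<le> (\<lambda>t. dual_f t + (dual_f t)\<^sup>2 - t) t"
    proof (rule DERIV_nonneg_imp_nondecreasing[OF that])
      fix s :: real assume "0 \<le> s"
      then have f: "dual_f s \<ge> 0" by (rule dual_f_nonneg)
      define w where "w = sqrt (1 + 2 * (dual_f s)\<^sup>2)"
      have w: "w > 0" unfolding w_def by (auto intro!: add_pos_nonneg)
      have "w \<le> 1 + 2 * dual_f s"
        unfolding w_def by (rule real_le_lsqrt) (use f in \<open>auto simp: power2_eq_square algebra_simps\<close>)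
      then have "0 \<le> (1 + 2 * dual_f s) / w - 1" using w by simp
      moreover have "((\<lambda>t. dual_f t + (dual_f t)\<^sup>2 - t) has_real_derivative
          (1 + 2 * dual_f s) / w - 1) (at s)"
        unfolding w_def by (auto intro!: derivative_eq_intros DERIV_dual_f simp: add_divide_distrib)
      ultimately show "\<exists>y. ((\<lambda>t. dual_f t + (dual_f t)\<^sup>2 - t) has_real_derivative y) (at s) \<and> 0 \<le> y"
        by blast
    qed
    then show ?thesis by simp
  qed
  show ?thesis
    using *[of t] *[of "- t"] dual_f_minus[of t] by (cases "t \<ge> 0") auto
qed

text \<open>Of the two terms bounding \<open>|t|\<close>, the first dominates where \<open>|f t| \<le> 1\<close> and the second elsewhere;
  this matches the linear growth of \<open>f\<close> near 0 and its square root growth at infinity.\<close>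

lemma min_square_abs_le_dual_f: "min (t\<^sup>2) \<bar>t\<bar> \<le> 4 * (dual_f t)\<^sup>2"
proof (cases "\<bar>dual_f t\<bar> \<le> 1")
  case True
  then have "(dual_f t)\<^sup>2 \<le> \<bar>dual_f t\<bar>"
    using mult_left_le_one_le[of "\<bar>dual_f t\<bar>" "\<bar>dual_f t\<bar>"] by (simp add: power2_eq_square)
  then have "\<bar>t\<bar> \<le> \<bar>2 * dual_f t\<bar>" using abs_le_dual_f[of t] by simp
  then have "t\<^sup>2 \<le> (2 * dual_f t)\<^sup>2" by (rule abs_le_square_iff[THEN iffD1])
  then show ?thesis by (simp add: power_mult_distrib)
next
  case False
  then have "\<bar>dual_f t\<bar> \<le> (dual_f t)\<^sup>2"
    using mult_left_mono[of 1 "\<bar>dual_f t\<bar>" "\<bar>dual_f t\<bar>"] by (simp add: power2_eq_square)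
  then show ?thesis using abs_le_dual_f[of t] by simp
qed

text \<open>This turns the integral at the scale \<open>k u\<close>, which \<open>norm_o\<close> controls, into one of \<open>u\<close> itself. The
  factor \<open>k\<^sup>2\<close> in the quadratic branch is at least \<open>k / 2\<close> only for \<open>k \<ge> 1/2\<close>, the range in which a nearly optimal \<open>k\<close> of a function of norm 1
  lies.\<close>

lemma min_square_abs_scale:
  fixes k t :: real
  assumes "k > 1/2"
  shows "min (t\<^sup>2) \<bar>t\<bar> \<le> 2 / k * min ((k * t)\<^sup>2) \<bar>k * t\<bar>"
proof -
  have "t\<^sup>2 * 1 \<le> t\<^sup>2 * (2 * k)" "\<bar>t\<bar> \<ge> 0" using assms by (intro mult_left_mono) auto
  then have "min (t\<^sup>2) \<bar>t\<bar> \<le> min (t\<^sup>2 * (2 * k)) (\<bar>t\<bar> * 2)" by (auto simp: min_def)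
  also have "\<dots> = min (2 / k * (k * t)\<^sup>2) (2 / k * \<bar>k * t\<bar>)"
    using assms by (simp add: power2_eq_square abs_mult field_simps)
  also have "\<dots> = 2 / k * min ((k * t)\<^sup>2) \<bar>k * t\<bar>"
    using assms by (simp add: min_mult_distrib_left)
  finally show ?thesis .
qed

section \<open>Polar coordinates for radial integrands\<close>

definition sphere_area :: "'a::euclidean_space itself \<Rightarrow> real" where
  "sphere_area _ = real DIM('a) * unit_ball_vol (real DIM('a))"

lemma sphere_area_pos: "sphere_area TYPE('a::euclidean_space) > 0"
  unfolding sphere_area_def by simp

definition radial_density :: "'a::euclidean_space itself \<Rightarrow> real \<Rightarrow> real" where
  "radial_density _ r = indicator {0..} r * (sphere_area TYPE('a) * r powr (real DIM('a) - 1))"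

lemma radial_density_measurable [measurable]:
  "radial_density TYPE('a::euclidean_space) \<in> borel_measurable borel"
  unfolding radial_density_def[abs_def] by measurable

text \<open>Both measures give \<open>{..a}\<close> the volume of a ball of radius \<open>a\<close>, and these sets form a generator
  closed under intersection.\<close>

lemma distr_norm_lborel:
  "distr (lborel :: 'a::euclidean_space measure) borel norm =
     density lborel (\<lambda>r. ennreal (radial_density TYPE('a) r))" (is "?L = ?R")
proof (rule measure_eqI_generator_eq[where E = "range (\<lambda>a::real. {..a})" and \<Omega> = UNIV
        and A = "\<lambda>n. {..real n}"])
  show "Int_stable (range (\<lambda>a::real. {..a}))"
    by (auto simp: Int_stable_def)
  show "sets ?L = sigma_sets UNIV (range (\<lambda>a::real. {..a}))"
    "sets ?R = sigma_sets UNIV (range (\<lambda>a::real. {..a}))"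
    by (simp_all add: borel_eq_atMost)
  have L: "emeasure ?L {..a} = (if a < 0 then 0 else ennreal (unit_ball_vol (real DIM('a)) * a ^ DIM('a)))" for a
  proof -
    have "emeasure ?L {..a} = emeasure lborel (norm -` {..a} \<inter> space (lborel :: 'a measure))"
      by (rule emeasure_distr) auto
    also have "norm -` {..a} \<inter> space (lborel :: 'a measure) = cball 0 a" by auto
    finally show ?thesis using emeasure_cball[of a "0::'a"] by auto
  qed
  show "emeasure ?L {..real n} \<noteq> \<infinity>" for n by (simp add: L)
  show "(\<Union>n. {..real n}) = UNIV" using real_arch_simple by auto
  show "emeasure ?L X = emeasure ?R X" if "X \<in> range (\<lambda>a::real. {..a})" for X
  proof -
    from that obtain a where X: "X = {..a}" by auto
    have "emeasure ?R X = (\<integral>\<^sup>+r. ennreal (radial_density TYPE('a) r) * indicator {..a} r \<partial>lborel)"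
      unfolding X by (rule emeasure_density) auto
    also have "\<dots> = (\<integral>\<^sup>+r. ennreal (sphere_area TYPE('a) * r powr (real DIM('a) - 1)) * indicator {0..a} r \<partial>lborel)"
      by (intro nn_integral_cong) (auto simp: radial_density_def indicator_def)
    also have "\<dots> = (if a < 0 then 0 else ennreal (unit_ball_vol (real DIM('a)) * a ^ DIM('a)))"
    proof (cases "a < 0")
      case False
      have "((\<lambda>r. sphere_area TYPE('a) * r powr (real DIM('a) - 1)) has_integral
          sphere_area TYPE('a) * (a powr (real DIM('a) - 1 + 1) / (real DIM('a) - 1 + 1))) {0..a}"
        by (intro has_integral_mult_right has_integral_powr_from_0) (use False in auto)
      from nn_integral_has_integral_lebesgue'[OF _ this]
      show ?thesis using False
        by (cases "a = 0") (auto simp: sphere_area_def powr_realpow intro!: mult_nonneg_nonneg)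
    qed simp
    finally show ?thesis by (simp add: X L)
  qed
qed auto

lemma nn_integral_radial:
  fixes h :: "real \<Rightarrow> ennreal"
  assumes [measurable]: "h \<in> borel_measurable borel"
  shows "(\<integral>\<^sup>+x. h (norm (x::'a::euclidean_space)) \<partial>lborel) =
    (\<integral>\<^sup>+r. ennreal (radial_density TYPE('a) r) * h r \<partial>lborel)"
proof -
  have "(\<integral>\<^sup>+x. h (norm (x::'a)) \<partial>lborel) = (\<integral>\<^sup>+r. h r \<partial>distr (lborel :: 'a measure) borel norm)"
    by (rule nn_integral_distr[symmetric]) auto
  also have "\<dots> = (\<integral>\<^sup>+r. ennreal (radial_density TYPE('a) r) * h r \<partial>lborel)"
    unfolding distr_norm_lborel by (rule nn_integral_density) auto
  finally show ?thesis .
qed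

lemma nn_integral_ball_norm_powr:
  assumes "\<epsilon> > 0" "R > 0"
  shows "(\<integral>\<^sup>+x\<in>ball 0 R. ennreal (norm (x::'a::euclidean_space) powr (\<epsilon> - real DIM('a))) \<partial>lborel)
    \<le> ennreal (sphere_area TYPE('a) / \<epsilon> * R powr \<epsilon>)"
proof -
  let ?N = "real DIM('a)"
  have "(\<integral>\<^sup>+x\<in>ball 0 R. ennreal (norm (x::'a) powr (\<epsilon> - ?N)) \<partial>lborel) =
     (\<integral>\<^sup>+x. (\<lambda>r. ennreal (r powr (\<epsilon> - ?N)) * indicator {..<R} r) (norm (x::'a)) \<partial>lborel)"
    by (intro nn_integral_cong) (auto simp: indicator_def)
  also have "\<dots> = (\<integral>\<^sup>+r. ennreal (radial_density TYPE('a) r) * (ennreal (r powr (\<epsilon> - ?N)) * indicator {..<R} r) \<partial>lborel)"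
    by (rule nn_integral_radial) auto
  also have "\<dots> \<le> (\<integral>\<^sup>+r. ennreal (sphere_area TYPE('a) * r powr (\<epsilon> - 1)) * indicator {0..R} r \<partial>lborel)"
  proof (intro nn_integral_mono)
    fix r :: real
    show "ennreal (radial_density TYPE('a) r) * (ennreal (r powr (\<epsilon> - ?N)) * indicator {..<R} r)
      \<le> ennreal (sphere_area TYPE('a) * r powr (\<epsilon> - 1)) * indicator {0..R} r"
    proof (cases "0 < r \<and> r < R")
      case True
      have "r powr (?N - 1) * r powr (\<epsilon> - ?N) = r powr (\<epsilon> - 1)"
        by (simp add: powr_add[symmetric])
      then show ?thesis using True sphere_area_pos[where 'a='a]
        by (simp add: radial_density_def ennreal_mult'[symmetric] mult.assoc)
    qed (auto simp: radial_density_def indicator_def)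
  qed
  also have "\<dots> = ennreal (sphere_area TYPE('a) * (R powr (\<epsilon> - 1 + 1) / (\<epsilon> - 1 + 1)))"
    by (intro nn_integral_has_integral_lebesgue' has_integral_mult_right has_integral_powr_from_0)
      (use assms sphere_area_pos[where 'a='a] in \<open>auto intro!: mult_nonneg_nonneg\<close>)
  finally show ?thesis by simp
qed

section \<open>Test functions and their radial profiles\<close>

lemma Cc_inf_differentiable:
  assumes "\<phi> \<in> Cc_inf"
  shows "\<phi> differentiable (at x)"
proof -
  have "Ck (Suc 0) \<phi>" using assms unfolding Cc_inf_def by blast
  then show ?thesis by (simp add: differentiable_on_def)
qed

lemma Cc_inf_continuous: "\<phi> \<in> Cc_inf \<Longrightarrow> continuous_on A \<phi>"
  by (meson Cc_inf_differentiable continuous_at_imp_continuous_on differentiable_imp_continuous_within)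

lemma Cc_inf_continuous_deriv:
  assumes "\<phi> \<in> Cc_inf" "b \<in> Basis"
  shows "continuous_on A (\<lambda>x. frechet_derivative \<phi> (at x) b)"
proof -
  have "Ck (Suc 0) \<phi>" using assms unfolding Cc_inf_def by blast
  then show ?thesis using assms(2) continuous_on_subset by fastforce
qed

lemma Cc_inf_continuous_grad: "\<phi> \<in> Cc_inf \<Longrightarrow> continuous_on A (grad \<phi>)"
  unfolding grad_def[abs_def] by (intro continuous_intros Cc_inf_continuous_deriv) auto

lemma grad_inner:
  assumes "\<phi> \<in> Cc_inf"
  shows "grad \<phi> x \<bullet> v = frechet_derivative \<phi> (at x) v"
proof -
  have lin: "linear (frechet_derivative \<phi> (at x))"
    by (rule linear_frechet_derivative[OF Cc_inf_differentiable[OF assms]])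
  have "frechet_derivative \<phi> (at x) v = frechet_derivative \<phi> (at x) (\<Sum>b\<in>Basis. (v \<bullet> b) *\<^sub>R b)"
    by (simp add: euclidean_representation)
  also have "\<dots> = (\<Sum>b\<in>Basis. (v \<bullet> b) * frechet_derivative \<phi> (at x) b)"
    by (simp add: linear_sum[OF lin] linear_scale[OF lin])
  also have "\<dots> = grad \<phi> x \<bullet> v"
    by (auto simp: grad_def inner_sum_left inner_commute[of v] mult.commute intro!: sum.cong)
  finally show ?thesis by simp
qed

lemma Cc_inf_bounded_support:
  assumes "\<phi> \<in> Cc_inf"
  obtains T where "T > 0" "\<And>x. norm x \<ge> T \<Longrightarrow> \<phi> x = 0" "\<And>x. norm x \<ge> T \<Longrightarrow> grad \<phi> x = 0"
proof -
  have "bounded (closure {x. \<phi> x \<noteq> 0})"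
    using assms unfolding Cc_inf_def by (auto intro: compact_imp_bounded)
  then obtain T0 where T0: "\<And>x. x \<in> closure {x. \<phi> x \<noteq> 0} \<Longrightarrow> norm x \<le> T0"
    unfolding bounded_iff by blast
  have z: "\<phi> x = 0" if "norm x > T0" for x
    using T0[of x] that closure_subset[of "{x. \<phi> x \<noteq> 0}"] by force
  have gz: "grad \<phi> x = 0" if "norm x > T0" for x
  proof -
    have op: "open {x::'a. norm x > T0}" by (intro open_Collect_less continuous_intros)
    have "(\<phi> has_derivative (\<lambda>_. 0)) (at x)"
      by (rule has_derivative_transform_within_open[OF has_derivative_const op]) (use that z in auto)
    then have "(\<lambda>_. 0) = frechet_derivative \<phi> (at x)" by (rule frechet_derivative_at)
    then show ?thesis unfolding grad_def by (metis (no_types, lifting) scale_zero_left sum.neutral)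
  qed
  show ?thesis by (rule that[of "max 1 (T0 + 1)"]) (use z gz in auto)
qed

lemma Cc_inf_grad_finite_energy:
  assumes "\<phi> \<in> Cc_inf"
  shows "(\<integral>\<^sup>+x. ennreal ((norm (grad \<phi> (x::'a::euclidean_space)))\<^sup>2) \<partial>lborel) < \<infinity>"
proof -
  obtain T where T: "T > 0" "\<And>x. norm x \<ge> T \<Longrightarrow> grad \<phi> x = 0"
    using Cc_inf_bounded_support[OF assms] by metis
  have "compact (grad \<phi> ` cball 0 T)"
    by (intro compact_continuous_image Cc_inf_continuous_grad assms compact_cball)
  then obtain B where B: "\<And>x. x \<in> cball 0 T \<Longrightarrow> norm (grad \<phi> x) \<le> B"
    by (meson bounded_iff compact_imp_bounded imageI)
  have "(\<integral>\<^sup>+x. ennreal ((norm (grad \<phi> x))\<^sup>2) \<partial>lborel) \<le> (\<integral>\<^sup>+x. ennreal (B\<^sup>2) * indicator (cball (0::'a) T) x \<partial>lborel)"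
  proof (intro nn_integral_mono)
    fix x :: 'a
    show "ennreal ((norm (grad \<phi> x))\<^sup>2) \<le> ennreal (B\<^sup>2) * indicator (cball 0 T) x"
      using B[of x] T(2)[of x] by (cases "norm x \<le> T") (auto intro!: ennreal_leI power_mono)
  qed
  also have "\<dots> = ennreal (B\<^sup>2) * emeasure lborel (cball (0::'a) T)"
    by (rule nn_integral_cmult_indicator) auto
  also have "\<dots> < \<infinity>"
    using emeasure_bounded_finite[of "cball (0::'a) T"] by (simp add: ennreal_mult_less_top)
  finally show ?thesis .
qed

text \<open>By radiality the profile is the same along every ray, so its derivative is the directional
  derivative of \<open>\<phi>\<close> at any point of the sphere, in the outward direction, and Cauchy-Schwarz
  applies there.\<close>

lemma radial_profile:
  assumes "\<phi> \<in> Cc_inf_rad" "e \<in> Basis"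
  shows radial_profile_eq: "\<phi> x = \<phi> (norm x *\<^sub>R e)"
    and radial_profile_deriv: "((\<lambda>s. \<phi> (s *\<^sub>R e)) has_real_derivative grad \<phi> (r *\<^sub>R e) \<bullet> e) (at r)"
    and radial_profile_deriv_le: "\<bar>grad \<phi> (norm x *\<^sub>R e) \<bullet> e\<bar> \<le> norm (grad \<phi> x)"
proof -
  have C: "\<phi> \<in> Cc_inf" using assms(1) unfolding Cc_inf_rad_def by blast
  have R: "\<phi> x = \<phi> y" if "norm x = norm y" for x y
    using assms(1) that unfolding Cc_inf_rad_def by blast
  show "\<phi> x = \<phi> (norm x *\<^sub>R e)" using assms(2) by (intro R) simp
  have D: "((\<lambda>s. \<phi> (s *\<^sub>R v)) has_real_derivative grad \<phi> (r *\<^sub>R v) \<bullet> v) (at r)" for v r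
  proof -
    have 1: "(\<phi> has_derivative frechet_derivative \<phi> (at (r *\<^sub>R v))) (at (r *\<^sub>R v))"
      using Cc_inf_differentiable[OF C] frechet_derivative_works by blast
    have 2: "((\<lambda>s. s *\<^sub>R v) has_derivative (\<lambda>h. h *\<^sub>R v)) (at r)"
      by (auto intro!: derivative_eq_intros)
    have "((\<lambda>s. \<phi> (s *\<^sub>R v)) has_derivative (\<lambda>h. grad \<phi> (r *\<^sub>R v) \<bullet> (h *\<^sub>R v))) (at r)"
      using has_derivative_compose[OF 2 1] by (simp only: grad_inner[OF C])
    moreover have "(\<lambda>h. grad \<phi> (r *\<^sub>R v) \<bullet> (h *\<^sub>R v)) = (*) (grad \<phi> (r *\<^sub>R v) \<bullet> v)"
      by (auto simp: mult.commute)
    ultimately show ?thesis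
      by (simp only: has_field_derivative_def)
  qed
  show "((\<lambda>s. \<phi> (s *\<^sub>R e)) has_real_derivative grad \<phi> (r *\<^sub>R e) \<bullet> e) (at r)" by (rule D)
  obtain v where v: "norm v = 1" "x = norm x *\<^sub>R v"
  proof (cases "x = 0")
    case True
    then show ?thesis using that[of e] assms(2) by simp
  next
    case False
    then show ?thesis using that[of "x /\<^sub>R norm x"] by simp
  qed
  have "(\<lambda>s. \<phi> (s *\<^sub>R v)) = (\<lambda>s. \<phi> (s *\<^sub>R e))"
    using v(1) assms(2) by (intro ext R) simp
  then have "grad \<phi> (norm x *\<^sub>R e) \<bullet> e = grad \<phi> (norm x *\<^sub>R v) \<bullet> v"
    using D[of v "norm x"] D[of e "norm x"] DERIV_unique by metis
  also have "\<bar>\<dots>\<bar> \<le> norm (grad \<phi> (norm x *\<^sub>R v)) * norm v" by (rule Cauchy_Schwarz_ineq2)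
  finally show "\<bar>grad \<phi> (norm x *\<^sub>R e) \<bullet> e\<bar> \<le> norm (grad \<phi> x)" using v by simp
qed

section \<open>Pointwise decay of radial functions\<close>

definition radial_const :: "'a::euclidean_space itself \<Rightarrow> real \<Rightarrow> real" where
  "radial_const _ A = A / (2 * sphere_area TYPE('a)) + 1 / (2 * (real DIM('a) - 2))"

text \<open>The value of the profile \<open>g\<close> at \<open>r\<close> is minus the integral of \<open>g'\<close> from \<open>r\<close> to a radius beyond the
  support. Splitting \<open>|g'|\<close> by the inequality of arithmetic and geometric means into a multiple of
  \<open>g'\<^sup>2 s\<^bsup>N-1\<^esup>\<close>, whose integral is at most the energy divided by \<open>sphere_area\<close>, and a multiple of
  \<open>s\<^bsup>1-N\<^esup>\<close>, which is integrable at infinity for \<open>N \<ge> 3\<close>, gives the bound.\<close>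

lemma radial_estimate_test_function:
  fixes \<phi> :: "'a::euclidean_space \<Rightarrow> real"
  assumes \<phi>: "\<phi> \<in> Cc_inf_rad" and dim: "DIM('a) \<ge> 3" and "x \<noteq> 0" and "A \<ge> 0"
    and energy: "(\<integral>\<^sup>+x. ennreal ((norm (grad \<phi> x))\<^sup>2) \<partial>lborel) \<le> ennreal A"
  shows "\<bar>\<phi> x\<bar> \<le> radial_const TYPE('a) A * norm x powr (- (real DIM('a) - 2) / 2)"
proof -
  define N where "N = real DIM('a)"
  define \<sigma> where "\<sigma> = sphere_area TYPE('a)"
  have N: "N \<ge> 3" using dim by (simp add: N_def)
  have \<sigma>: "\<sigma> > 0" unfolding \<sigma>_def by (rule sphere_area_pos)
  have C: "\<phi> \<in> Cc_inf" using \<phi> unfolding Cc_inf_rad_def by auto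
  obtain e :: 'a where e: "e \<in> Basis" using nonempty_Basis by blast
  define r where "r = norm x"
  have r: "r > 0" using \<open>x \<noteq> 0\<close> by (simp add: r_def)
  define g where "g s = \<phi> (s *\<^sub>R e)" for s
  define g' where "g' s = grad \<phi> (s *\<^sub>R e) \<bullet> e" for s
  have g_deriv: "(g has_real_derivative g' s) (at s)" for s
    unfolding g_def[abs_def] g'_def by (rule radial_profile_deriv[OF \<phi> e])
  have g'_cont: "continuous_on S g'" for S
    unfolding g'_def[abs_def]
    by (intro continuous_intros continuous_on_compose2[OF Cc_inf_continuous_grad[OF C, of UNIV]]) auto
  then have [measurable]: "g' \<in> borel_measurable borel"
    by (rule borel_measurable_continuous_onI)
  obtain T0 where T0: "\<And>x. norm x \<ge> T0 \<Longrightarrow> \<phi> x = 0"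
    using Cc_inf_bounded_support[OF C] by metis
  define T where "T = max r T0"
  have rT: "r \<le> T" and gT: "g T = 0"
    using T0[of "T *\<^sub>R e"] e r by (auto simp: T_def g_def)
  have cont: "continuous_on {r..T} (\<lambda>s. (g' s)\<^sup>2 * s powr (N - 1))"
    using r by (intro continuous_intros g'_cont) auto
  define J where "J = integral {r..T} (\<lambda>s. (g' s)\<^sup>2 * s powr (N - 1))"
  have J: "((\<lambda>s. (g' s)\<^sup>2 * s powr (N - 1)) has_integral J) {r..T}"
    unfolding J_def by (intro integrable_integral integrable_continuous_real cont)
  have "J \<ge> 0" using has_integral_nonneg[OF J] by simp
  have "ennreal (\<sigma> * J) = (\<integral>\<^sup>+s. ennreal (\<sigma> * ((g' s)\<^sup>2 * s powr (N - 1))) * indicator {r..T} s \<partial>lborel)"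
    by (rule nn_integral_has_integral_lebesgue'[symmetric])
      (use \<sigma> in \<open>auto intro!: has_integral_mult_right J\<close>)
  also have "\<dots> \<le> (\<integral>\<^sup>+s. ennreal (radial_density TYPE('a) s) * ennreal ((g' s)\<^sup>2) \<partial>lborel)"
    using r \<sigma> by (intro nn_integral_mono)
      (auto simp: radial_density_def indicator_def N_def \<sigma>_def ennreal_mult'[symmetric] ac_simps)
  also have "\<dots> = (\<integral>\<^sup>+x. ennreal ((g' (norm (x::'a)))\<^sup>2) \<partial>lborel)"
    by (rule nn_integral_radial[symmetric]) auto
  also have "\<dots> \<le> (\<integral>\<^sup>+x. ennreal ((norm (grad \<phi> x))\<^sup>2) \<partial>lborel)"
  proof (intro nn_integral_mono ennreal_leI)
    fix x :: 'a
    show "(g' (norm x))\<^sup>2 \<le> (norm (grad \<phi> x))\<^sup>2"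
      using radial_profile_deriv_le[OF \<phi> e, of x] unfolding g'_def
      by (metis abs_ge_zero power2_abs power_mono)
  qed
  also note energy
  finally have "\<sigma> * J \<le> A" using \<open>A \<ge> 0\<close> by simp
  then have JA: "J \<le> A / \<sigma>" using \<sigma> by (simp add: field_simps)
  have I: "((\<lambda>s. s powr (1 - N)) has_integral
      T powr (2 - N) / (2 - N) - r powr (2 - N) / (2 - N)) {r..T}"
  proof (rule fundamental_theorem_of_calculus[OF rT])
    fix s assume "s \<in> {r..T}"
    then have "s > 0" using r by simp
    then have "((\<lambda>s. s powr (2 - N) / (2 - N)) has_real_derivative s powr (1 - N)) (at s)"
      using N by (auto intro!: derivative_eq_intros)
    then show "((\<lambda>s. s powr (2 - N) / (2 - N)) has_vector_derivative s powr (1 - N)) (at s within {r..T})"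
      using has_real_derivative_iff_has_vector_derivative has_vector_derivative_at_within by blast
  qed
  \<comment> \<open>With this weight both halves of the split below scale like the same power of \<open>r\<close>.\<close>
  define \<mu> where "\<mu> = r powr (- (N - 2) / 2)"
  have \<mu>: "\<mu> > 0" using r by (simp add: \<mu>_def)
  have bound: "((\<lambda>s. \<mu> / 2 * ((g' s)\<^sup>2 * s powr (N - 1)) + 1 / (2 * \<mu>) * s powr (1 - N)) has_integral
     \<mu> / 2 * J + 1 / (2 * \<mu>) * (T powr (2 - N) / (2 - N) - r powr (2 - N) / (2 - N))) {r..T}"
    by (intro has_integral_add has_integral_mult_right J I)
  have FTC: "(g' has_integral g T - g r) {r..T}"
    by (rule fundamental_theorem_of_calculus[OF rT])
      (use g_deriv has_real_derivative_iff_has_vector_derivative has_vector_derivative_at_within in blast)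
  have "norm (integral {r..T} g') \<le> integral {r..T}
      (\<lambda>s. \<mu> / 2 * ((g' s)\<^sup>2 * s powr (N - 1)) + 1 / (2 * \<mu>) * s powr (1 - N))"
  proof (rule integral_norm_bound_integral)
    fix s assume "s \<in> {r..T}"
    then have s: "s > 0" using r by simp
    define p where "p = s powr (N - 1)"
    have p: "p > 0" "s powr (1 - N) = 1 / p"
      using s by (auto simp: p_def powr_minus_divide[symmetric])
    \<comment> \<open>The arithmetic-geometric mean split of \<open>|g'|\<close> is a complete square.\<close>
    have "0 \<le> (\<mu> * p * \<bar>g' s\<bar> - 1)\<^sup>2" by simp
    then have "2 * (\<mu> * p) * \<bar>g' s\<bar> \<le> (\<mu> * p)\<^sup>2 * (g' s)\<^sup>2 + 1"
      by (simp add: power2_eq_square algebra_simps)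
    then have "2 * (\<mu> * p) * \<bar>g' s\<bar> / (2 * (\<mu> * p)) \<le> ((\<mu> * p)\<^sup>2 * (g' s)\<^sup>2 + 1) / (2 * (\<mu> * p))"
      by (rule divide_right_mono) (use \<mu> p in auto)
    also have "2 * (\<mu> * p) * \<bar>g' s\<bar> / (2 * (\<mu> * p)) = \<bar>g' s\<bar>"
      using \<mu> p by simp
    also have "((\<mu> * p)\<^sup>2 * (g' s)\<^sup>2 + 1) / (2 * (\<mu> * p)) = \<mu> / 2 * ((g' s)\<^sup>2 * p) + 1 / (2 * \<mu>) * (1 / p)"
      using \<mu> p by (simp add: field_simps power2_eq_square)
    finally show "norm (g' s) \<le> \<mu> / 2 * ((g' s)\<^sup>2 * s powr (N - 1)) + 1 / (2 * \<mu>) * s powr (1 - N)"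
      unfolding p(2) p_def by simp
  qed (use FTC bound in \<open>auto simp: has_integral_iff\<close>)
  also have "integral {r..T} g' = - g r" using integral_unique[OF FTC] gT by simp
  also have "integral {r..T} (\<lambda>s. \<mu> / 2 * ((g' s)\<^sup>2 * s powr (N - 1)) + 1 / (2 * \<mu>) * s powr (1 - N))
      = \<mu> / 2 * J + 1 / (2 * \<mu>) * (T powr (2 - N) / (2 - N) - r powr (2 - N) / (2 - N))"
    by (rule integral_unique[OF bound])
  also have "\<dots> \<le> \<mu> / 2 * (A / \<sigma>) + 1 / (2 * \<mu>) * (r powr (2 - N) / (N - 2))"
  proof (intro add_mono mult_left_mono JA)
    have "T powr (2 - N) / (2 - N) \<le> 0" using N by (simp add: divide_nonneg_neg)
    moreover have "r powr (2 - N) / (2 - N) = - (r powr (2 - N) / (N - 2))"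
      by (metis minus_diff_eq minus_divide_right)
    ultimately show "T powr (2 - N) / (2 - N) - r powr (2 - N) / (2 - N) \<le> r powr (2 - N) / (N - 2)"
      by linarith
  qed (use \<mu> in auto)
  also have "r powr (2 - N) = \<mu> * \<mu>"
    by (simp add: \<mu>_def powr_add[symmetric])
  also have "\<mu> / 2 * (A / \<sigma>) + 1 / (2 * \<mu>) * (\<mu> * \<mu> / (N - 2)) = (A / (2 * \<sigma>) + 1 / (2 * (N - 2))) * \<mu>"
    using \<mu> \<sigma> N by (simp add: field_simps)
  finally have "\<bar>g r\<bar> \<le> (A / (2 * \<sigma>) + 1 / (2 * (N - 2))) * \<mu>" by simp
  moreover have "\<phi> x = g r" unfolding g_def r_def by (rule radial_profile_eq[OF \<phi> e])
  ultimately show ?thesis by (simp add: radial_const_def N_def \<sigma>_def \<mu>_def r_def)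
qed

lemma measurable_if_locally_absolutely_integrable:
  fixes f :: "'a::euclidean_space \<Rightarrow> 'b::euclidean_space"
  assumes "\<And>S. compact S \<Longrightarrow> f absolutely_integrable_on S"
  shows "f \<in> borel_measurable lebesgue"
proof (rule borel_measurable_LIMSEQ_metric)
  show "(\<lambda>x. indicator (cball 0 (real n)) x *\<^sub>R f x) \<in> borel_measurable lebesgue" for n
    using assms[of "cball 0 (real n)"] unfolding set_integrable_def by auto
  fix x :: 'a
  obtain m where m: "norm x \<le> real m" using real_arch_simple by blast
  have "\<forall>\<^sub>F n in sequentially. indicator (cball 0 (real n)) x *\<^sub>R f x = f x"
    using eventually_ge_at_top[of m]
  proof eventually_elim
    case (elim n)
    then show ?case using m by (simp add: order_trans[OF m])
  qed
  then show "(\<lambda>n. indicator (cball 0 (real n)) x *\<^sub>R f x) \<longlonglongrightarrow> f x"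
    by (rule tendsto_eventually)
qed

lemma D12_rad_measurable:
  assumes "u \<in> D12_rad"
  shows "u \<in> borel_measurable lebesgue" "weak_grad u \<in> borel_measurable lebesgue"
proof -
  have "has_weak_grad u (weak_grad u)"
    using assms someI_ex[of "has_weak_grad u"] unfolding D12_rad_def weak_grad_def by blast
  then show "u \<in> borel_measurable lebesgue" "weak_grad u \<in> borel_measurable lebesgue"
    unfolding has_weak_grad_def by (blast intro: measurable_if_locally_absolutely_integrable)+
qed

lemma nn_integral_square_norm_triangle:
  fixes F G :: "'a::euclidean_space \<Rightarrow> 'b::euclidean_space"
  assumes [measurable]: "F \<in> borel_measurable M" "G \<in> borel_measurable M"
  shows "(\<integral>\<^sup>+x. ennreal ((norm (F x))\<^sup>2) \<partial>M) \<le>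
    2 * (\<integral>\<^sup>+x. ennreal ((norm (F x - G x))\<^sup>2) \<partial>M) + 2 * (\<integral>\<^sup>+x. ennreal ((norm (G x))\<^sup>2) \<partial>M)"
proof -
  have "(norm a)\<^sup>2 \<le> 2 * (norm (a - b))\<^sup>2 + 2 * (norm b)\<^sup>2" for a b :: 'b
  proof -
    have "norm a \<le> norm (a - b) + norm b" by (metis diff_add_cancel norm_triangle_ineq)
    then have "(norm a)\<^sup>2 \<le> (norm (a - b) + norm b)\<^sup>2" by (rule power_mono) simp
    also have "\<dots> \<le> 2 * (norm (a - b))\<^sup>2 + 2 * (norm b)\<^sup>2"
      using sum_squares_bound[of "norm (a - b)" "norm b"] by (simp add: power2_sum)
    finally show ?thesis .
  qed
  then have "(\<integral>\<^sup>+x. ennreal ((norm (F x))\<^sup>2) \<partial>M) \<le>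
     (\<integral>\<^sup>+x. 2 * ennreal ((norm (F x - G x))\<^sup>2) + 2 * ennreal ((norm (G x))\<^sup>2) \<partial>M)"
  proof (intro nn_integral_mono)
    fix x
    assume *: "\<And>a b::'b. (norm a)\<^sup>2 \<le> 2 * (norm (a - b))\<^sup>2 + 2 * (norm b)\<^sup>2"
    have "ennreal ((norm (F x))\<^sup>2) \<le> ennreal (2 * (norm (F x - G x))\<^sup>2 + 2 * (norm (G x))\<^sup>2)"
      by (intro ennreal_leI *)
    then show "ennreal ((norm (F x))\<^sup>2) \<le> 2 * ennreal ((norm (F x - G x))\<^sup>2) + 2 * ennreal ((norm (G x))\<^sup>2)"
      by (simp add: ennreal_plus ennreal_mult)
  qed
  also have "\<dots> = 2 * (\<integral>\<^sup>+x. ennreal ((norm (F x - G x))\<^sup>2) \<partial>M) + 2 * (\<integral>\<^sup>+x. ennreal ((norm (G x))\<^sup>2) \<partial>M)"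
    by (simp add: nn_integral_add nn_integral_cmult)
  finally show ?thesis .
qed

text \<open>Once the gradients of the approximating test functions are within distance 1 of a field of norm at
  most 1, their energies are at most 4, so they share one pointwise bound. Convergence of the
  functions in the critical \<open>L\<close> space makes the lower limit of \<open>|\<phi> n - u|\<close> vanish almost everywhere
  by Fatou, and the bound passes to \<open>u\<close>.\<close>

lemma radial_estimate_D12_rad:
  fixes u :: "'a::euclidean_space \<Rightarrow> real"
  assumes u: "u \<in> D12_rad" and dim: "DIM('a) \<ge> 3" and norm: "norm12 u \<le> 1"
  shows "AE x in lebesgue. \<bar>u x\<bar> \<le> radial_const TYPE('a) 4 * norm x powr (- (real DIM('a) - 2) / 2)"
proof -
  define G where "G = weak_grad u"
  have [measurable]: "u \<in> borel_measurable lebesgue" "G \<in> borel_measurable lebesgue"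
    using D12_rad_measurable[OF u] by (auto simp: G_def)
  define p where "p = sobolev_exp (real DIM('a))"
  have p: "p > 0" using dim by (simp add: p_def sobolev_exp_def)
  obtain \<phi> where \<phi>: "\<And>n. \<phi> n \<in> Cc_inf_rad"
    and lim_grad: "(\<lambda>n. \<integral>\<^sup>+x. ennreal ((norm (grad (\<phi> n) x - G x))\<^sup>2) \<partial>lebesgue) \<longlonglongrightarrow> 0"
    and lim: "(\<lambda>n. \<integral>\<^sup>+x. ennreal (\<bar>\<phi> n x - u x\<bar> powr p) \<partial>lebesgue) \<longlonglongrightarrow> 0"
    using u unfolding D12_rad_def G_def p_def by blast
  have C: "\<phi> n \<in> Cc_inf" for n using \<phi>[of n] unfolding Cc_inf_rad_def by auto
  have meas [measurable]: "\<phi> n \<in> borel_measurable lebesgue" "grad (\<phi> n) \<in> borel_measurable lebesgue" for n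
    by (auto intro!: measurable_completion borel_measurable_continuous_onI
        Cc_inf_continuous Cc_inf_continuous_grad C)
  have "\<forall>\<^sub>F n in sequentially. (\<integral>\<^sup>+x. ennreal ((norm (grad (\<phi> n) x - G x))\<^sup>2) \<partial>lebesgue) < 1"
    using lim_grad by (rule order_tendstoD) simp
  then obtain n0 where n0: "\<And>n. n \<ge> n0 \<Longrightarrow> (\<integral>\<^sup>+x. ennreal ((norm (grad (\<phi> n) x - G x))\<^sup>2) \<partial>lebesgue) < 1"
    unfolding eventually_sequentially by blast
  \<comment> \<open>\<open>norm12\<close> is the root of a Bochner integral, which is 0 if the energy is infinite, so finiteness has to be
    known before \<open>norm12 u \<le> 1\<close> says anything.\<close>
  have Gfin: "(\<integral>\<^sup>+x. ennreal ((norm (G x))\<^sup>2) \<partial>lebesgue) < \<infinity>"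
  proof -
    have "(\<integral>\<^sup>+x. ennreal ((norm (G x))\<^sup>2) \<partial>lebesgue) \<le>
        2 * (\<integral>\<^sup>+x. ennreal ((norm (G x - grad (\<phi> n0) x))\<^sup>2) \<partial>lebesgue) +
        2 * (\<integral>\<^sup>+x. ennreal ((norm (grad (\<phi> n0) x))\<^sup>2) \<partial>lebesgue)"
      by (rule nn_integral_square_norm_triangle) auto
    also have "\<dots> < \<infinity>"
      using n0[of n0] Cc_inf_grad_finite_energy[OF C[of n0]]
      by (auto simp: norm_minus_commute nn_integral_completion ennreal_mult_less_top
          intro: less_trans)
    finally show ?thesis .
  qed
  then have int: "integrable lebesgue (\<lambda>x. (norm (G x))\<^sup>2)"
    by (intro integrableI_bounded) auto
  have "(\<integral>\<^sup>+x. ennreal ((norm (G x))\<^sup>2) \<partial>lebesgue) = ennreal (LINT x|lebesgue. (norm (G x))\<^sup>2)"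
    by (rule nn_integral_eq_integral[OF int]) auto
  also have "\<dots> \<le> ennreal 1"
    using norm unfolding norm12_def G_def by (intro ennreal_leI) simp
  finally have G1: "(\<integral>\<^sup>+x. ennreal ((norm (G x))\<^sup>2) \<partial>lebesgue) \<le> 1" by simp
  define B where "B x = radial_const TYPE('a) 4 * norm x powr (- (real DIM('a) - 2) / 2)" for x :: 'a
  have \<phi>B: "\<bar>\<phi> n x\<bar> \<le> B x" if "n \<ge> n0" "x \<noteq> 0" for n x
    unfolding B_def
  proof (rule radial_estimate_test_function[OF \<phi> dim \<open>x \<noteq> 0\<close>])
    have "(\<integral>\<^sup>+x. ennreal ((norm (grad (\<phi> n) x))\<^sup>2) \<partial>lebesgue) \<le>
        2 * (\<integral>\<^sup>+x. ennreal ((norm (grad (\<phi> n) x - G x))\<^sup>2) \<partial>lebesgue) +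
        2 * (\<integral>\<^sup>+x. ennreal ((norm (G x))\<^sup>2) \<partial>lebesgue)"
      by (rule nn_integral_square_norm_triangle) auto
    also have "\<dots> \<le> 2 * 1 + 2 * 1"
      using n0[OF \<open>n \<ge> n0\<close>] by (intro add_mono mult_left_mono G1) auto
    finally show "(\<integral>\<^sup>+x. ennreal ((norm (grad (\<phi> n) x))\<^sup>2) \<partial>lborel) \<le> ennreal 4"
      by (simp add: nn_integral_completion)
  qed simp
  have "(\<integral>\<^sup>+x. liminf (\<lambda>n. ennreal (\<bar>\<phi> n x - u x\<bar> powr p)) \<partial>lebesgue)
      \<le> liminf (\<lambda>n. \<integral>\<^sup>+x. ennreal (\<bar>\<phi> n x - u x\<bar> powr p) \<partial>lebesgue)"
    by (rule nn_integral_liminf) auto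
  also have "\<dots> = 0" using lim_imp_Liminf[OF _ lim] by simp
  finally have "(\<integral>\<^sup>+x. liminf (\<lambda>n. ennreal (\<bar>\<phi> n x - u x\<bar> powr p)) \<partial>lebesgue) = 0" by simp
  then have "AE x in lebesgue. liminf (\<lambda>n. ennreal (\<bar>\<phi> n x - u x\<bar> powr p)) = 0"
    by (subst (asm) nn_integral_0_iff_AE) auto
  moreover have "AE x in lebesgue. x \<noteq> (0::'a)"
    by (rule AE_completion) (rule AE_lborel_singleton)
  ultimately show ?thesis
    unfolding B_def[symmetric]
  proof eventually_elim
    case (elim x)
    show ?case
    proof (rule ccontr)
      assume "\<not> \<bar>u x\<bar> \<le> B x"
      then have d: "\<bar>u x\<bar> - B x > 0" by simp
      have "ennreal ((\<bar>u x\<bar> - B x) powr p) \<le> liminf (\<lambda>n. ennreal (\<bar>\<phi> n x - u x\<bar> powr p))"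
      proof (rule Liminf_bounded)
        show "\<forall>\<^sub>F n in sequentially. ennreal ((\<bar>u x\<bar> - B x) powr p) \<le> ennreal (\<bar>\<phi> n x - u x\<bar> powr p)"
          using eventually_ge_at_top[of n0]
        proof eventually_elim
          case (elim n)
          have "\<bar>u x\<bar> - B x \<le> \<bar>\<phi> n x - u x\<bar>" using \<phi>B[OF elim \<open>x \<noteq> 0\<close>] by linarith
          then show ?case using d p by (intro ennreal_leI powr_mono2) auto
        qed
      qed
      moreover have "(\<bar>u x\<bar> - B x) powr p > 0" using d by simp
      ultimately show False using elim by simp
    qed
  qed
qed

section \<open>The weighted integral on the unit sphere of the norm\<close>

lemma radial_weight_measurable:
  fixes V :: "real \<Rightarrow> real"
  assumes "continuous_on {0<..} V"
  shows "(\<lambda>x::'a::euclidean_space. V (norm x)) \<in> borel_measurable borel"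
proof -
  have "(\<lambda>r. indicator {0<..} r *\<^sub>R V r) \<in> borel_measurable borel"
    by (rule borel_measurable_continuous_on_indicator) (use assms in auto)
  then have [measurable]: "(\<lambda>x::'a. indicator {0<..} (norm x) *\<^sub>R V (norm x)) \<in> borel_measurable borel"
    by (rule measurable_compose[rotated]) simp
  have "(\<lambda>x::'a. V (norm x)) =
      (\<lambda>x. indicator {0<..} (norm x) *\<^sub>R V (norm x) + indicator {0} x *\<^sub>R V 0)"
    by (auto simp: fun_eq_iff indicator_def)
  also have "\<dots> \<in> borel_measurable borel"
    by measurable
  finally show ?thesis .
qed

lemma weighted_integral_le_if_norm_o_le_1:
  fixes u :: "'a::euclidean_space \<Rightarrow> real"
  assumes V: "continuous_on {0<..} V" "\<And>r. r > 0 \<Longrightarrow> V r \<ge> 0"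
    and u [measurable]: "u \<in> borel_measurable lebesgue"
    and le: "norm_o V u \<le> 1"
  shows "(\<integral>\<^sup>+x. ennreal (V (norm x) * min ((u x)\<^sup>2) \<bar>u x\<bar>) \<partial>lebesgue) \<le> 16"
proof -
  have [measurable]: "(\<lambda>x::'a. V (norm x)) \<in> borel_measurable lebesgue"
    by (intro measurable_completion) (use radial_weight_measurable[OF V(1)] in simp)
  have f_meas [measurable]: "dual_f \<in> borel_measurable borel"
    by (intro borel_measurable_continuous_onI continuous_on_dual_f)
  define I where "I k = (\<integral>\<^sup>+x. ennreal (V (norm x) * (dual_f (k * u x))\<^sup>2) \<partial>lebesgue)" for k
  \<comment> \<open>The infimum need not be attained; any bound above 1 leaves room to choose \<open>k\<close>, and the bound 2
    forces \<open>k > 1/2\<close>.\<close>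
  have "norm_o V u < 2" using le by (rule order_le_less_trans) simp
  then obtain k where k: "k > 0" "ennreal (1 / k) * (1 + I k) < 2"
    unfolding norm_o_def I_def INF_less_iff by auto
  have "ennreal (1 / k) \<le> ennreal (1 / k) * (1 + I k)"
    using mult_left_mono[of 1 "1 + I k" "ennreal (1 / k)"] by simp
  then have "ennreal (1 / k) < ennreal 2" using k(2) by (metis ennreal_numeral order_le_less_trans zero_le_numeral)
  then have k2: "k > 1/2" using k(1) by (simp add: ennreal_less_iff field_simps)
  have "ennreal (1 / k) * I k \<le> ennreal (1 / k) * (1 + I k)"
    by (intro mult_left_mono) auto
  then have Ik: "ennreal (1 / k) * I k \<le> 2" using k(2) by (meson le_less_trans less_imp_le)
  have "AE x in lebesgue. x \<noteq> (0::'a)"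
    by (rule AE_completion) (rule AE_lborel_singleton)
  then have "AE x in lebesgue. ennreal (V (norm x) * min ((u x)\<^sup>2) \<bar>u x\<bar>) \<le>
      ennreal (8 / k) * ennreal (V (norm x) * (dual_f (k * u x))\<^sup>2)"
  proof eventually_elim
    case (elim x)
    have "min ((u x)\<^sup>2) \<bar>u x\<bar> \<le> 2 / k * min ((k * u x)\<^sup>2) \<bar>k * u x\<bar>"
      by (rule min_square_abs_scale[OF k2])
    also have "\<dots> \<le> 2 / k * (4 * (dual_f (k * u x))\<^sup>2)"
      by (intro mult_left_mono min_square_abs_le_dual_f) (use k in simp)
    finally have "V (norm x) * min ((u x)\<^sup>2) \<bar>u x\<bar> \<le> V (norm x) * (8 / k * (dual_f (k * u x))\<^sup>2)"
      using V(2)[of "norm x"] elim by (intro mult_left_mono) auto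
    then show ?case
      using k by (subst ennreal_mult'[symmetric]) (auto intro!: ennreal_leI simp: ac_simps)
  qed
  then have "(\<integral>\<^sup>+x. ennreal (V (norm x) * min ((u x)\<^sup>2) \<bar>u x\<bar>) \<partial>lebesgue) \<le>
      (\<integral>\<^sup>+x. ennreal (8 / k) * ennreal (V (norm x) * (dual_f (k * u x))\<^sup>2) \<partial>lebesgue)"
    by (rule nn_integral_mono_AE)
  also have "\<dots> = ennreal (8 / k) * I k"
    unfolding I_def by (rule nn_integral_cmult) measurable
  also have "ennreal (8 / k) = 8 * ennreal (1 / k)"
    using ennreal_mult'[of 8 "1 / k"] by simp
  also have "8 * ennreal (1 / k) * I k \<le> 8 * 2"
    unfolding mult.assoc by (intro mult_left_mono Ik) simp
  finally show ?thesis by simp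
qed

section \<open>Splitting the integrand near the origin\<close>

text \<open>The power \<open>|t|\<^sup>q\<close> is \<open>min t\<^sup>2 |t|\<close> to the power \<open>\<beta>\<close> times a remainder, which is \<open>|t|\<close> to the power
  \<open>q - \<beta>\<close> for \<open>|t| \<ge> 1\<close>, to be estimated by the bound on \<open>|t|\<close> in terms of \<open>r\<close>, and is at most 1 for
  \<open>|t| < 1\<close>, because \<open>q \<ge> 2 \<beta>\<close>. The remaining power of \<open>r\<close> has exponent \<open>\<epsilon> \<beta> + (\<epsilon> - N) (1 - \<beta>)\<close>, which turns the product
  into a weighted geometric mean of the two terms on the right. This plays the part of Hoelder's
  inequality with exponents \<open>1 / \<beta>\<close> and \<open>1 / (1 - \<beta>)\<close> and includes the end points \<open>\<beta> = 0\<close> and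
  \<open>\<beta> = 1\<close>.\<close>

lemma weighted_power_bound:
  fixes r t v :: real
  assumes r: "0 < r" "r < 1" and \<beta>: "0 \<le> \<beta>" "\<beta> \<le> 1" and q: "\<beta> \<le> q" "2 * \<beta> \<le> q"
    and A: "1 \<le> A" "\<bar>t\<bar> \<le> A * r powr (- (N - 2) / 2)" and N: "N \<ge> 2" and v: "v \<ge> 0"
    and \<epsilon>: "\<epsilon> = \<alpha> - (N - 2) / 2 * (q - \<beta>) + N * (1 - \<beta>)"
  shows "r powr \<alpha> * (if \<beta> = 0 then 1 else v powr \<beta>) * \<bar>t\<bar> powr q \<le>
    A powr (q - \<beta>) * (r powr \<epsilon> * (v * min (t\<^sup>2) \<bar>t\<bar>) + r powr (\<epsilon> - N))"
proof (cases "t = 0")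
  case True
  then show ?thesis by simp
next
  case False
  define m where "m = min (t\<^sup>2) \<bar>t\<bar>"
  have m: "m > 0" using False by (simp add: m_def)
  define w where "w = (if \<beta> = 0 then 1 else v powr \<beta>)"
  have w: "w \<ge> 0" by (simp add: w_def)
  define \<rho> where "\<rho> = r powr (- (N - 2) / 2 * (q - \<beta>))"
  have e: "- (N - 2) / 2 * (q - \<beta>) \<le> 0"
    by (intro mult_nonpos_nonneg) (use N q in simp_all)
  have "r powr 0 \<le> \<rho>" unfolding \<rho>_def
    by (rule powr_mono') (use r e in linarith)+
  then have \<rho>: "\<rho> \<ge> 1" using r by simp
  have A1: "A powr (q - \<beta>) \<ge> 1" using A q by (simp add: ge_one_powr_ge_zero)
  have "\<bar>t\<bar> powr q \<le> m powr \<beta> * (A powr (q - \<beta>) * \<rho>)"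
  proof (cases "\<bar>t\<bar> \<ge> 1")
    case True
    then have "\<bar>t\<bar> * 1 \<le> \<bar>t\<bar> * \<bar>t\<bar>" by (intro mult_left_mono) auto
    then have m_eq: "m = \<bar>t\<bar>" by (simp add: m_def power2_eq_square)
    have "\<bar>t\<bar> powr (q - \<beta>) \<le> (A * r powr (- (N - 2) / 2)) powr (q - \<beta>)"
      by (rule powr_mono2) (use q A in auto)
    also have "\<dots> = A powr (q - \<beta>) * \<rho>"
      unfolding \<rho>_def using A r by (simp only: powr_mult powr_powr)
    finally have "\<bar>t\<bar> powr \<beta> * \<bar>t\<bar> powr (q - \<beta>) \<le> \<bar>t\<bar> powr \<beta> * (A powr (q - \<beta>) * \<rho>)"
      by (rule mult_left_mono) simp
    then show ?thesis by (simp add: m_eq powr_add[symmetric])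
  next
    case t1: False
    then have "\<bar>t\<bar> * \<bar>t\<bar> \<le> \<bar>t\<bar> * 1" by (intro mult_left_mono) auto
    then have m_eq: "m = \<bar>t\<bar> powr 2" using False by (simp add: m_def power2_eq_square powr_numeral)
    have "\<bar>t\<bar> powr q \<le> \<bar>t\<bar> powr (2 * \<beta>)"
      by (rule powr_mono') (use q t1 in auto)
    also have "\<dots> = m powr \<beta> * 1" by (simp add: m_eq powr_powr del: powr_numeral)
    also have "\<dots> \<le> m powr \<beta> * (A powr (q - \<beta>) * \<rho>)"
      using mult_mono[OF A1 \<rho>] by (intro mult_left_mono) auto
    finally show ?thesis .
  qed
  then have "r powr \<alpha> * w * \<bar>t\<bar> powr q \<le> r powr \<alpha> * w * (m powr \<beta> * (A powr (q - \<beta>) * \<rho>))"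
    by (rule mult_left_mono) (use w in simp)
  also have "\<dots> = A powr (q - \<beta>) * (r powr \<alpha> * \<rho> * (w * m powr \<beta>))" by simp
  also have "r powr \<alpha> * \<rho> = r powr (\<epsilon> * \<beta> + (\<epsilon> - N) * (1 - \<beta>))"
  proof -
    have "\<epsilon> * \<beta> + (\<epsilon> - N) * (1 - \<beta>) = \<epsilon> - N * (1 - \<beta>)" by (simp add: algebra_simps)
    also have "\<dots> = \<alpha> + - (N - 2) / 2 * (q - \<beta>)" unfolding \<epsilon> by (simp add: field_simps)
    finally show ?thesis by (simp only: \<rho>_def powr_add[symmetric])
  qed
  also have "A powr (q - \<beta>) * (r powr (\<epsilon> * \<beta> + (\<epsilon> - N) * (1 - \<beta>)) * (w * m powr \<beta>)) \<le>
      A powr (q - \<beta>) * (r powr \<epsilon> * (v * m) + r powr (\<epsilon> - N))"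
  proof (rule mult_left_mono)
    show "r powr (\<epsilon> * \<beta> + (\<epsilon> - N) * (1 - \<beta>)) * (w * m powr \<beta>) \<le> r powr \<epsilon> * (v * m) + r powr (\<epsilon> - N)"
    proof (cases "\<beta> = 0")
      case True
      then show ?thesis using v m by (simp add: w_def)
    next
      case False
      define a where "a = r powr \<epsilon> * (v * m)"
      define b where "b = r powr (\<epsilon> - N)"
      have ab: "a \<ge> 0" "b > 0" using v m r by (auto simp: a_def b_def)
      have "r powr (\<epsilon> * \<beta> + (\<epsilon> - N) * (1 - \<beta>)) * (w * m powr \<beta>) = a powr \<beta> * b powr (1 - \<beta>)"
        using v m r False by (simp add: a_def b_def w_def powr_mult powr_powr powr_add)
      also have "\<dots> \<le> max a b powr \<beta> * max a b powr (1 - \<beta>)"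
        using ab \<beta> by (intro mult_mono powr_mono2) auto
      also have "\<dots> = max a b" using ab by (simp add: powr_add[symmetric])
      also have "\<dots> \<le> a + b" using ab by simp
      finally show ?thesis by (simp add: a_def b_def)
    qed
  qed simp
  finally show ?thesis by (simp add: w_def m_def)
qed

text \<open>A finite supremum excludes \<open>V r = 0\<close> for \<open>\<beta> > 0\<close>: there the quotient is infinite since
  \<open>K r > 0\<close>.\<close>

lemma weight_quotient_bounded:
  assumes "\<And>r. r > 0 \<Longrightarrow> K r > 0"
    and "(SUP r\<in>{0<..<R}. weight_quotient K V \<alpha> \<beta> r) < \<infinity>"
  obtains M where "M \<ge> 0"
    "\<And>r. 0 < r \<Longrightarrow> r < R \<Longrightarrow> K r \<le> M * (r powr \<alpha> * (if \<beta> = 0 then 1 else V r powr \<beta>))"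
proof -
  define M where "M = enn2real (SUP r\<in>{0<..<R}. weight_quotient K V \<alpha> \<beta> r)"
  have M: "ennreal M = (SUP r\<in>{0<..<R}. weight_quotient K V \<alpha> \<beta> r)"
    unfolding M_def using assms(2) by (simp add: less_top)
  have "K r \<le> M * (r powr \<alpha> * (if \<beta> = 0 then 1 else V r powr \<beta>))" if r: "0 < r" "r < R" for r
  proof -
    define w where "w = r powr \<alpha> * (if \<beta> = 0 then 1 else V r powr \<beta>)"
    have w0: "w \<ge> 0" by (simp add: w_def)
    have le: "ennreal (K r) / ennreal w \<le> ennreal M"
      unfolding M w_def weight_quotient_def[symmetric] by (rule SUP_upper) (use r in simp)
    have K: "K r > 0" using assms(1) r by simp
    have "w \<noteq> 0"
    proof
      assume "w = 0"
      then have "ennreal (K r) / ennreal w = \<infinity>" using K by (simp add: ennreal_divide_zero)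
      then show False using le by (simp add: top_unique)
    qed
    then have w: "w > 0" using w0 by simp
    then have "ennreal (K r / w) \<le> ennreal M" using le K by (simp add: divide_ennreal)
    then have "K r / w \<le> M" by (simp add: M_def)
    then show ?thesis using w by (simp add: field_simps w_def)
  qed
  then show ?thesis using that[of M] by (simp add: M_def)
qed

section \<open>Decay of the supremum on small balls\<close>

text \<open>On the ball the factor \<open>|x|\<^sup>\<epsilon>\<close> in front of \<open>V m(u)\<close> is at most \<open>R\<^sup>\<epsilon>\<close>, and the singular term is
  integrable because \<open>\<epsilon> > 0\<close>, with integral proportional to \<open>R\<^sup>\<epsilon>\<close>.\<close>

lemma S0_le_powr:
  fixes V K :: "real \<Rightarrow> real"
  assumes dim: "DIM('a::euclidean_space) \<ge> 3"
    and V: "continuous_on {0<..} V" "\<And>r. r > 0 \<Longrightarrow> V r \<ge> 0"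
    and K: "\<And>r. 0 < r \<Longrightarrow> r < R\<^sub>1 \<Longrightarrow> K r \<le> M * (r powr \<alpha> * (if \<beta> = 0 then 1 else V r powr \<beta>))"
    and M: "M \<ge> 0" and \<beta>: "0 \<le> \<beta>" "\<beta> \<le> 1" and q: "\<beta> \<le> q" "2 * \<beta> \<le> q"
    and \<epsilon>: "\<epsilon> = \<alpha> - (real DIM('a) - 2) / 2 * (q - \<beta>) + real DIM('a) * (1 - \<beta>)" "\<epsilon> > 0"
  obtains C where
    "\<And>R. 0 < R \<Longrightarrow> R \<le> R\<^sub>1 \<Longrightarrow> R \<le> 1 \<Longrightarrow> S0 TYPE('a) V K q R \<le> ennreal (C * R powr \<epsilon>)"
proof -
  define N where "N = real DIM('a)"
  define \<sigma> where "\<sigma> = sphere_area TYPE('a)"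
  have \<sigma>: "\<sigma> > 0" unfolding \<sigma>_def by (rule sphere_area_pos)
  define A where "A = max 1 (radial_const TYPE('a) 4)"
  define c where "c = M * A powr (q - \<beta>)"
  have c: "c \<ge> 0" using M by (simp add: c_def)
  have "S0 TYPE('a) V K q R \<le> ennreal (c * (16 + \<sigma> / \<epsilon>) * R powr \<epsilon>)"
    if R: "0 < R" "R \<le> R\<^sub>1" "R \<le> 1" for R
    unfolding S0_def
  proof (rule SUP_least)
    fix u :: "'a \<Rightarrow> real"
    assume "u \<in> {u. u \<in> E_space V \<and> E_norm V u = 1}"
    then have uD: "u \<in> D12_rad" and nrm: "ennreal (norm12 u) + norm_o V u = 1"
      by (auto simp: E_space_def E_norm_def)
    have "ennreal (norm12 u) \<le> 1" and no: "norm_o V u \<le> 1"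
      using nrm by (metis le_iff_add, metis add.commute le_iff_add)
    then have n12: "norm12 u \<le> 1" by simp
    have [measurable]: "u \<in> borel_measurable lebesgue" using uD by (rule D12_rad_measurable)
    have [measurable]: "(\<lambda>x::'a. V (norm x)) \<in> borel_measurable lebesgue"
      by (intro measurable_completion) (use radial_weight_measurable[OF V(1)] in simp)
    have [measurable]: "ball (0::'a) R \<in> sets lebesgue" by simp
    have "AE x in lebesgue. x \<noteq> (0::'a)"
      by (rule AE_completion) (rule AE_lborel_singleton)
    with radial_estimate_D12_rad[OF uD dim n12]
    have ae: "AE x in lebesgue. ennreal (K (norm x) * \<bar>u x\<bar> powr q) * indicator (ball 0 R) x \<le>
        ennreal c * (ennreal (R powr \<epsilon>) * ennreal (V (norm x) * min ((u x)\<^sup>2) \<bar>u x\<bar>) +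
          ennreal (norm x powr (\<epsilon> - N)) * indicator (ball 0 R) x)"
    proof eventually_elim
      case (elim x)
      show ?case
      proof (cases "x \<in> ball 0 R")
        case True
        define r where "r = norm x"
        have r: "0 < r" "r < R" using True elim by (auto simp: r_def)
        have Vm: "V r * min ((u x)\<^sup>2) \<bar>u x\<bar> \<ge> 0"
          using V(2)[OF r(1)] by (intro mult_nonneg_nonneg) auto
        have "\<bar>u x\<bar> \<le> radial_const TYPE('a) 4 * r powr (- (N - 2) / 2)"
          using elim(1) by (simp add: r_def N_def)
        also have "\<dots> \<le> A * r powr (- (N - 2) / 2)"
          by (intro mult_right_mono) (auto simp: A_def)
        finally have uA: "\<bar>u x\<bar> \<le> A * r powr (- (N - 2) / 2)" .
        have "K r * \<bar>u x\<bar> powr q \<le> M * (r powr \<alpha> * (if \<beta> = 0 then 1 else V r powr \<beta>)) * \<bar>u x\<bar> powr q"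
          using r R by (intro mult_right_mono K) auto
        also have "\<dots> = M * (r powr \<alpha> * (if \<beta> = 0 then 1 else V r powr \<beta>) * \<bar>u x\<bar> powr q)" by simp
        also have "\<dots> \<le> M * (A powr (q - \<beta>) * (r powr \<epsilon> * (V r * min ((u x)\<^sup>2) \<bar>u x\<bar>) + r powr (\<epsilon> - N)))"
          by (intro mult_left_mono weighted_power_bound \<beta> q uA M V)
            (use r R dim \<epsilon> in \<open>auto simp: A_def N_def\<close>)
        also have "\<dots> \<le> c * (R powr \<epsilon> * (V r * min ((u x)\<^sup>2) \<bar>u x\<bar>) + r powr (\<epsilon> - N))"
          unfolding c_def mult.assoc[symmetric]
          using Vm V(2)[OF r(1)] r \<epsilon>(2) M
          by (intro mult_left_mono add_right_mono mult_right_mono powr_mono2) (auto simp: mult.assoc)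
        finally have "ennreal (K r * \<bar>u x\<bar> powr q) \<le>
            ennreal (c * (R powr \<epsilon> * (V r * min ((u x)\<^sup>2) \<bar>u x\<bar>) + r powr (\<epsilon> - N)))"
          by (rule ennreal_leI)
        then show ?thesis
          using True Vm c by (simp add: r_def ennreal_mult ennreal_plus del: mem_ball)
      qed simp
    qed
    have "(\<integral>\<^sup>+x\<in>ball 0 R. ennreal (K (norm x) * \<bar>u x\<bar> powr q) \<partial>lebesgue) \<le>
       (\<integral>\<^sup>+x. ennreal c * (ennreal (R powr \<epsilon>) * ennreal (V (norm x) * min ((u x)\<^sup>2) \<bar>u x\<bar>) +
          ennreal (norm x powr (\<epsilon> - N)) * indicator (ball 0 R) x) \<partial>lebesgue)"
      by (rule nn_integral_mono_AE[OF ae])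
    also have "\<dots> = ennreal c * (ennreal (R powr \<epsilon>) *
          (\<integral>\<^sup>+x. ennreal (V (norm x) * min ((u x)\<^sup>2) \<bar>u x\<bar>) \<partial>lebesgue) +
        (\<integral>\<^sup>+x\<in>ball (0::'a) R. ennreal (norm x powr (\<epsilon> - N)) \<partial>lebesgue))"
    proof -
      have [measurable]: "(\<lambda>x::'a. ennreal (norm x powr (\<epsilon> - N))) \<in> borel_measurable lebesgue"
        by (intro measurable_completion) measurable
      show ?thesis by (simp add: nn_integral_cmult nn_integral_add)
    qed
    also have "\<dots> \<le> ennreal c * (ennreal (R powr \<epsilon>) * ennreal 16 + ennreal (\<sigma> / \<epsilon> * R powr \<epsilon>))"
    proof (intro mult_left_mono add_mono)
      show "(\<integral>\<^sup>+x. ennreal (V (norm x) * min ((u x)\<^sup>2) \<bar>u x\<bar>) \<partial>lebesgue) \<le> ennreal 16"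
        using weighted_integral_le_if_norm_o_le_1[OF V _ no] by simp
      show "(\<integral>\<^sup>+x\<in>ball (0::'a) R. ennreal (norm x powr (\<epsilon> - N)) \<partial>lebesgue) \<le> ennreal (\<sigma> / \<epsilon> * R powr \<epsilon>)"
        unfolding nn_integral_completion N_def \<sigma>_def
        by (rule nn_integral_ball_norm_powr[OF \<epsilon>(2) R(1)])
    qed auto
    also have "\<dots> = ennreal (c * (16 + \<sigma> / \<epsilon>) * R powr \<epsilon>)"
    proof -
      define X where "X = \<sigma> / \<epsilon> * R powr \<epsilon>"
      have "X \<ge> 0" using \<sigma> \<epsilon>(2) by (simp add: X_def)
      then have "ennreal c * (ennreal (R powr \<epsilon>) * ennreal 16 + ennreal X) = ennreal (c * (R powr \<epsilon> * 16 + X))"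
        using c by (simp add: ennreal_mult)
      then show ?thesis by (simp add: X_def algebra_simps)
    qed
    finally show "(\<integral>\<^sup>+x\<in>ball 0 R. ennreal (K (norm x) * \<bar>u x\<bar> powr q) \<partial>lebesgue) \<le>
      ennreal (c * (16 + \<sigma> / \<epsilon>) * R powr \<epsilon>)" .
  qed
  then show ?thesis using that by blast
qed

theorem theorem3p2:
  fixes V K :: "real \<Rightarrow> real" and \<alpha>\<^sub>0 \<beta>\<^sub>0 N :: real
  assumes "CARD('n::finite) \<ge> 3" and "N = real CARD('n)"
    and "continuous_on {0<..} V" and "\<And>r. r > 0 \<Longrightarrow> V r \<ge> 0"
    and "continuous_on {0<..} K" and "\<And>r. r > 0 \<Longrightarrow> K r > 0"
    and "\<exists>C>0. \<forall>r\<in>{0<..<1}. V r \<le> C / r\<^sup>2"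
    and "0 \<le> \<beta>\<^sub>0" and "\<beta>\<^sub>0 \<le> 1" and "\<alpha>\<^sub>0 > alpha_star N \<beta>\<^sub>0"
    and "\<exists>R\<^sub>1>0. (SUP r\<in>{0<..<R\<^sub>1}. weight_quotient K V \<alpha>\<^sub>0 \<beta>\<^sub>0 r) < \<infinity>"
  shows "\<forall>q\<^sub>1::real. max 1 (2 * \<beta>\<^sub>0) < q\<^sub>1 \<and> q\<^sub>1 < q0_star N \<alpha>\<^sub>0 \<beta>\<^sub>0 \<longrightarrow>
    ((\<lambda>R. S0 TYPE(real ^ 'n) V K q\<^sub>1 R) \<longlongrightarrow> 0) (at_right 0)"
proof (intro allI impI)
  fix q :: real
  assume q: "max 1 (2 * \<beta>\<^sub>0) < q \<and> q < q0_star N \<alpha>\<^sub>0 \<beta>\<^sub>0"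
  have N: "N \<ge> 3" using assms(1,2) by simp
  define \<epsilon> where "\<epsilon> = \<alpha>\<^sub>0 - (N - 2) / 2 * (q - \<beta>\<^sub>0) + N * (1 - \<beta>\<^sub>0)"
  \<comment> \<open>Positivity of \<open>\<epsilon>\<close> is the inequality \<open>q < q0_star N \<alpha>\<^sub>0 \<beta>\<^sub>0\<close> multiplied by \<open>(N - 2) / 2\<close>.\<close>
  have "q * (N - 2) < 2 * \<alpha>\<^sub>0 + 2 * N - \<beta>\<^sub>0 * (N + 2)"
    using q N by (simp add: q0_star_def pos_less_divide_eq)
  then have \<epsilon>: "\<epsilon> > 0" by (simp add: \<epsilon>_def field_simps)
  obtain R\<^sub>1 where R1: "R\<^sub>1 > 0" "(SUP r\<in>{0<..<R\<^sub>1}. weight_quotient K V \<alpha>\<^sub>0 \<beta>\<^sub>0 r) < \<infinity>"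
    using assms(11) by blast
  obtain M where M: "M \<ge> 0" "\<And>r. 0 < r \<Longrightarrow> r < R\<^sub>1 \<Longrightarrow>
      K r \<le> M * (r powr \<alpha>\<^sub>0 * (if \<beta>\<^sub>0 = 0 then 1 else V r powr \<beta>\<^sub>0))"
    using weight_quotient_bounded[OF assms(6) R1(2)] by blast
  have dim: "DIM(real ^ 'n) \<ge> 3" using assms(1) by simp
  have \<epsilon>_eq: "\<epsilon> = \<alpha>\<^sub>0 - (real DIM(real ^ 'n) - 2) / 2 * (q - \<beta>\<^sub>0) + real DIM(real ^ 'n) * (1 - \<beta>\<^sub>0)"
    using assms(2) by (simp add: \<epsilon>_def)
  have q': "\<beta>\<^sub>0 \<le> q" "2 * \<beta>\<^sub>0 \<le> q" using q assms(9) by auto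
  obtain C where C: "\<And>R. 0 < R \<Longrightarrow> R \<le> R\<^sub>1 \<Longrightarrow> R \<le> 1 \<Longrightarrow>
      S0 TYPE(real ^ 'n) V K q R \<le> ennreal (C * R powr \<epsilon>)"
    using S0_le_powr[OF dim assms(3,4) M(2,1) assms(8,9) q' \<epsilon>_eq \<epsilon>] by blast
  have "((\<lambda>R. C * R powr \<epsilon>) \<longlongrightarrow> C * 0 powr \<epsilon>) (at_right 0)"
    using \<epsilon> by (intro tendsto_intros tendsto_powr') (auto simp: eventually_at_right_less intro: eventually_at_rightI[of 0 1])
  then have lim: "((\<lambda>R. ennreal (C * R powr \<epsilon>)) \<longlongrightarrow> 0) (at_right 0)"
    using tendsto_ennrealI by fastforce
  show "((\<lambda>R. S0 TYPE(real ^ 'n) V K q R) \<longlongrightarrow> 0) (at_right 0)"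
  proof (rule tendsto_sandwich[OF _ _ tendsto_const lim])
    show "\<forall>\<^sub>F R in at_right 0. S0 TYPE(real ^ 'n) V K q R \<le> ennreal (C * R powr \<epsilon>)"
      by (rule eventually_at_rightI[of 0 "min R\<^sub>1 1"]) (use R1 C in auto)
  qed simp
qed

end
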